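(* If $X$ is a quasi-Polish space, then the lower powerspace $\mathbf{A}(X)$ is quasi-Polish.
   Context: A subset $A$ of a topological space $Y$ is a $\mathbf{\Pi}^0_2$-subset if there are sequences $(U_i)_{i\in\omega}$ and $(V_i)_{i\in\omega}$ of open subsets of $Y$ such that $x\in A$ if and only if for all $i\in\omega$, $x\in U_i$ implies $x\in V_i$. A topological space is quasi-Polish if it is countably based and its topology is induced by a Smyth-complete quasi-metric; equivalently, if it is homeomorphic to a $\mathbf{\Pi}^0_2$-subset of an $\omega$-algebraic domain with the Scott topology (one may always take the domain to be $\mathcal{P}(\omega)$, the powerset of $\omega$ ordered by inclusion, with the Scott topology). The lower powerspace $\mathbf{A}(X)$ is the set of all closed subsets of $X$ (including $\emptyset$) with the lower Vietoris topology, which is generated by the sets $\Diamond U=\{A\in\mathbf{A}(X)\mid A\cap U\neq\emptyset\}$ for $U\subseteq X$ open. *)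

theory Defs
  imports "HOL-Analysis.Analysis"
begin

(* As in Metric_space, the distance is total and non-negative everywhere;
   only its values on M matter. *)
locale Quasi_metric_space =
  fixes M :: "'a set" and d :: "'a \<Rightarrow> 'a \<Rightarrow> real"
  assumes nonneg: "\<And>x y. 0 \<le> d x y"
    and zero: "\<And>x y. \<lbrakk>x \<in> M; y \<in> M\<rbrakk> \<Longrightarrow> (d x y = 0 \<and> d y x = 0) \<longleftrightarrow> x = y"
    and triangle: "\<And>x y z. \<lbrakk>x \<in> M; y \<in> M; z \<in> M\<rbrakk> \<Longrightarrow> d x z \<le> d x y + d y z"
begin

definition qball :: "'a \<Rightarrow> real \<Rightarrow> 'a set" where
  "qball x r = {y \<in> M. d x y < r}"

definition qtopology :: "'a topology" where
  "qtopology = topology_generated_by {qball x r |x r. x \<in> M \<and> 0 < r}"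

definition sym_dist :: "'a \<Rightarrow> 'a \<Rightarrow> real" where
  "sym_dist x y = max (d x y) (d y x)"

(* The order of the indices matters: distances are taken from earlier to later terms. *)
definition qCauchy :: "(nat \<Rightarrow> 'a) \<Rightarrow> bool" where
  "qCauchy \<sigma> \<longleftrightarrow> range \<sigma> \<subseteq> M \<and>
     (\<forall>\<epsilon>>0. \<exists>N. \<forall>n m. N \<le> n \<longrightarrow> n \<le> m \<longrightarrow> d (\<sigma> n) (\<sigma> m) < \<epsilon>)"

(* Convergence is required in the symmetrised metric, not merely in qtopology. *)
definition Smyth_complete :: bool where
  "Smyth_complete \<longleftrightarrow>
     (\<forall>\<sigma>. qCauchy \<sigma> \<longrightarrow> (\<exists>l. limitin (Metric_space.mtopology M sym_dist) \<sigma> l sequentially))"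

lemma topspace_qtopology: "topspace qtopology = M"
proof -
  have "x \<in> \<Union>{qball x r |x r. x \<in> M \<and> 0 < r}" if "x \<in> M" for x
  proof (rule UnionI)
    show "qball x 1 \<in> {qball x r |x r. x \<in> M \<and> 0 < r}"
      using that zero_less_one by blast
    show "x \<in> qball x 1"
      using that zero[OF that that] by (simp add: qball_def)
  qed
  then show ?thesis
    unfolding qtopology_def topology_generated_by_topspace by (fastforce simp: qball_def)
qed

lemma Metric_space_sym_dist: "Metric_space M sym_dist"
proof
  fix x y z
  show "0 \<le> sym_dist x y"
    by (simp add: sym_dist_def nonneg le_max_iff_disj)
  show "sym_dist x y = sym_dist y x"
    by (simp add: sym_dist_def max.commute)
  show "sym_dist x y = 0 \<longleftrightarrow> x = y" if "x \<in> M" "y \<in> M"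
    using zero[OF that] nonneg[of x y] nonneg[of y x] by (auto simp: sym_dist_def max_def)
  show "sym_dist x z \<le> sym_dist x y + sym_dist y z" if "x \<in> M" "y \<in> M" "z \<in> M"
    using triangle[OF that] triangle[OF that(3) that(2) that(1)] unfolding sym_dist_def by linarith
qed

end

definition quasi_Polish :: "'a topology \<Rightarrow> bool" where
  "quasi_Polish X \<longleftrightarrow> second_countable X \<and>
     (\<exists>d. Quasi_metric_space (topspace X) d \<and>
          Quasi_metric_space.qtopology (topspace X) d = X \<and>
          Quasi_metric_space.Smyth_complete (topspace X) d)"

definition diamond :: "'a topology \<Rightarrow> 'a set \<Rightarrow> 'a set set" where
  "diamond X U = {A. closedin X A \<and> A \<inter> U \<noteq> {}}"

(* No diamond contains the empty set, and topology_generated_by takes the union of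
   the generators as its underlying space; the whole space is therefore inserted as
   a generator, so that the empty set is a point of the lower powerspace. *)
definition lower_powerspace :: "'a topology \<Rightarrow> 'a set topology" where
  "lower_powerspace X =
     topology_generated_by (insert {A. closedin X A} {diamond X U |U. openin X U})"

lemma topspace_lower_powerspace: "topspace (lower_powerspace X) = {A. closedin X A}"
  by (auto simp: lower_powerspace_def diamond_def)

end

theory Submission
  imports Defs
begin

text \<open>
  A countable base of formal balls \<open>B j\<close> of \<open>X\<close> embeds the lower powerspace into the powerset of the
  naturals by \<open>A \<mapsto> {j. B j \<inter> A \<noteq> {}}\<close>. By Smyth completeness, the upward closed sets \<open>S\<close> in the
  image are those for which each \<open>i \<in> S\<close> has, for all \<open>n\<close>, some \<open>j \<in> S\<close> with \<open>B j\<close> strictly inside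
  \<open>B i\<close> and of radius below \<open>2\<^sup>-\<^sup>n\<close>. The least such \<open>j\<close> is a rank of \<open>A\<close>, infinite if there is none,
  which can only be lowered on small neighbourhoods of \<open>A\<close>. The quasi-metric that compares two
  closed sets by the first pair \<open>(i, n)\<close> at which the rank increases keeps these witnesses \<open>j\<close>
  from escaping to infinity along a Cauchy sequence, and is therefore Smyth complete.
\<close>

section \<open>Neighbourhoods in a topology given by generators\<close>

text \<open>Induction over the generation of \<open>U\<close>; binary intersections are the case
  that calls for directedness of the \<open>N t\<close>. It serves both balls indexed by their
  radius and rank conditions indexed by their length.\<close>

lemma openin_topology_generated_by_nhd:
  assumes "openin (topology_generated_by \<S>) U" "x \<in> U"
    and basis: "\<And>s. s \<in> \<S> \<Longrightarrow> x \<in> s \<Longrightarrow> \<exists>t. P t \<and> N t \<subseteq> s"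
    and directed: "\<And>t u. P t \<Longrightarrow> P u \<Longrightarrow> \<exists>v. P v \<and> N v \<subseteq> N t \<inter> N u"
  shows "\<exists>t. P t \<and> N t \<subseteq> U"
proof -
  have "generate_topology_on \<S> U"
    using assms(1) by (simp add: openin_topology_generated_by_iff)
  then show ?thesis
    using assms(2)
  proof induction
    case Empty
    then show ?case by simp
  next
    case (Int a b)
    then obtain t u where "P t" "N t \<subseteq> a" "P u" "N u \<subseteq> b" by blast
    with directed[of t u] show ?case by blast
  next
    case (UN K)
    then obtain k where "k \<in> K" "x \<in> k" by blast
    with UN.IH[of k] show ?case by blast
  next
    case (Basis s)
    with basis show ?case by blast
  qed
qed

section \<open>The quasi-metric induced by a sequence of ranks\<close>

text \<open>An asymmetric form of the distance on Baire space: only an increase of rank from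
  \<open>x\<close> to \<open>y\<close> costs something. Decreases are free because the sets on which
  a rank stays below a bound are to be open.\<close>

definition rank_dist :: "(nat \<Rightarrow> 'a \<Rightarrow> enat) \<Rightarrow> 'a \<Rightarrow> 'a \<Rightarrow> real" where
  "rank_dist h x y =
     (if \<forall>k. h k y \<le> h k x then 0 else (1/2) ^ (LEAST k. \<not> h k y \<le> h k x))"

lemma rank_dist_nonneg: "0 \<le> rank_dist h x y"
  by (simp add: rank_dist_def)

lemma rank_dist_eq_0_iff: "rank_dist h x y = 0 \<longleftrightarrow> (\<forall>k. h k y \<le> h k x)"
  by (simp add: rank_dist_def)

lemma rank_dist_less_iff: "rank_dist h x y < (1/2) ^ K \<longleftrightarrow> (\<forall>k\<le>K. h k y \<le> h k x)"
proof (cases "\<forall>k. h k y \<le> h k x")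
  case True
  then show ?thesis by (simp add: rank_dist_def)
next
  case False
  define l where "l = (LEAST k. \<not> h k y \<le> h k x)"
  have l: "\<not> h l y \<le> h l x" "\<And>k. k < l \<Longrightarrow> h k y \<le> h k x"
    using False LeastI_ex[of "\<lambda>k. \<not> h k y \<le> h k x"] not_less_Least[of _ "\<lambda>k. \<not> h k y \<le> h k x"]
    unfolding l_def by blast+
  have "rank_dist h x y < (1/2) ^ K \<longleftrightarrow> K < l"
    using False unfolding rank_dist_def l_def[symmetric] by (simp only: if_False) simp
  also have "\<dots> \<longleftrightarrow> (\<forall>k\<le>K. h k y \<le> h k x)"
    using l by (meson le_less_trans not_le)
  finally show ?thesis .
qed

text \<open>The ultrametric inequality holds: where a rank first increases from \<open>x\<close> to
  \<open>z\<close>, it must increase from \<open>x\<close> to \<open>y\<close> or from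
  \<open>y\<close> to \<open>z\<close>.\<close>

lemma rank_dist_triangle: "rank_dist h x z \<le> rank_dist h x y + rank_dist h y z"
proof -
  have "rank_dist h x z \<le> max (rank_dist h x y) (rank_dist h y z)"
  proof (cases "\<forall>k. h k z \<le> h k x")
    case True
    then show ?thesis by (simp add: rank_dist_def le_max_iff_disj)
  next
    case False
    define l where "l = (LEAST k. \<not> h k z \<le> h k x)"
    have "\<not> h l z \<le> h l x"
      unfolding l_def using False by (metis (mono_tags, lifting) LeastI_ex)
    then have "\<not> h l y \<le> h l x \<or> \<not> h l z \<le> h l y"
      using order_trans by blast
    then have "\<not> rank_dist h x y < (1/2) ^ l \<or> \<not> rank_dist h y z < (1/2) ^ l"
      unfolding rank_dist_less_iff by blast
    moreover have "rank_dist h x z = (1/2) ^ l"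
      using False by (simp add: rank_dist_def l_def)
    ultimately show ?thesis by (auto simp: le_max_iff_disj not_less)
  qed
  then show ?thesis
    using rank_dist_nonneg[of h x y] rank_dist_nonneg[of h y z] by linarith
qed

lemma small_half_power:
  assumes "0 < (e::real)" obtains K :: nat where "(1/2) ^ K < e"
  using real_arch_pow_inv[OF assms, of "1/2"] by auto

text \<open>\<open>enat\<close> is well-ordered, so the tail of the sequence attains a least value,
  and a decreasing tail cannot leave it.\<close>

lemma enat_eventually_const:
  fixes a :: "nat \<Rightarrow> enat"
  assumes "\<And>n m. N \<le> n \<Longrightarrow> n \<le> m \<Longrightarrow> a m \<le> a n"
  shows "\<exists>c. \<forall>\<^sub>F n in sequentially. a n = c"
proof -
  define c where "c = (LEAST c. c \<in> a ` {N..})"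
  have "c \<in> a ` {N..}"
    unfolding c_def by (rule LeastI[of _ "a N"]) simp
  then obtain p where p: "N \<le> p" "a p = c" by auto
  have "a n = c" if "p \<le> n" for n
  proof (rule antisym)
    show "a n \<le> c" using assms[OF p(1) that] p(2) by simp
    show "c \<le> a n" unfolding c_def by (rule Least_le) (use p(1) that in auto)
  qed
  then show ?thesis unfolding eventually_sequentially by blast
qed

text \<open>A Cauchy sequence of \<^const>\<open>rank_dist\<close> has eventually decreasing, hence eventually
  constant ranks, so Smyth completeness says that the limiting ranks are realised by a point.\<close>

lemma quasi_Polish_if_ranks:
  fixes h :: "nat \<Rightarrow> 'a \<Rightarrow> enat"
  assumes open_rank: "\<And>k m. openin X {x \<in> topspace X. h k x \<le> enat m}"
    and nhd: "\<And>U x. openin X U \<Longrightarrow> x \<in> U \<Longrightarrow>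
      \<exists>K. {y \<in> topspace X. \<forall>k\<le>K. h k y \<le> h k x} \<subseteq> U"
    and sep: "\<And>x y. x \<in> topspace X \<Longrightarrow> y \<in> topspace X \<Longrightarrow> (\<And>k. h k x = h k y) \<Longrightarrow> x = y"
    and lim: "\<And>\<sigma> c. range \<sigma> \<subseteq> topspace X \<Longrightarrow> (\<And>k. \<forall>\<^sub>F n in sequentially. h k (\<sigma> n) = c k) \<Longrightarrow>
      \<exists>x\<in>topspace X. \<forall>k. h k x = c k"
  shows "quasi_Polish X"
proof -
  have open_rank': "openin X {x \<in> topspace X. h k x \<le> e}" for k e
    using open_rank[of k] by (cases e) auto
  \<comment> \<open>Indexing by lists over \<open>enat\<close>, of which there are countably many,
    makes these finite rank conditions a countable base.\<close>
  define N where "N es = {y \<in> topspace X. \<forall>k<length es. h k y \<le> es ! k}" for es :: "enat list"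
  have open_N: "openin X (N es)" for es
  proof -
    have "N es = topspace X \<inter> (\<Inter>k<length es. {y \<in> topspace X. h k y \<le> es ! k})"
      by (auto simp: N_def)
    also have "openin X \<dots>"
      using open_rank' by (cases "length es = 0") (auto intro!: openin_Int openin_INT2)
    finally show ?thesis .
  qed
  define ranks where "ranks x K = map (\<lambda>k. h k x) [0..<Suc K]" for x K
  have N_ranks: "N (ranks x K) = {y \<in> topspace X. \<forall>k\<le>K. h k y \<le> h k x}" for x K
    by (auto simp: N_def ranks_def less_Suc_eq_le nth_append simp del: upt_Suc)
  have "second_countable X"
    unfolding second_countable_def
  proof (intro exI conjI ballI allI impI)
    show "countable (range N)" by simp
    show "openin X V" if "V \<in> range N" for V using that open_N by auto
    fix U x assume "openin X U \<and> x \<in> U"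
    then have U: "openin X U" "x \<in> U" by auto
    then have "x \<in> topspace X" using openin_subset by blast
    obtain K where "{y \<in> topspace X. \<forall>k\<le>K. h k y \<le> h k x} \<subseteq> U"
      using nhd U by blast
    then have "N (ranks x K) \<subseteq> U" "x \<in> N (ranks x K)"
      using \<open>x \<in> topspace X\<close> unfolding N_ranks by auto
    then show "\<exists>V\<in>range N. x \<in> V \<and> V \<subseteq> U" by blast
  qed
  moreover
  interpret Quasi_metric_space "topspace X" "rank_dist h"
  proof
    show "rank_dist h x y = 0 \<and> rank_dist h y x = 0 \<longleftrightarrow> x = y"
      if "x \<in> topspace X" "y \<in> topspace X" for x y
      using sep[OF that] by (metis rank_dist_eq_0_iff antisym order_refl)
  qed (rule rank_dist_nonneg rank_dist_triangle)+
  have qball_half: "qball x ((1/2) ^ K) = {y \<in> topspace X. \<forall>k\<le>K. h k y \<le> h k x}" for x K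
    by (simp add: qball_def rank_dist_less_iff)
  have open_qball: "openin X (qball x r)" for x r
  proof (subst openin_subopen, intro ballI)
    fix y assume "y \<in> qball x r"
    then have y: "y \<in> topspace X" "rank_dist h x y < r"
      by (auto simp: qball_def)
    then obtain K where K: "(1/2) ^ K < r - rank_dist h x y"
      using small_half_power[of "r - rank_dist h x y"] by auto
    have "qball y ((1/2) ^ K) \<subseteq> qball x r"
    proof
      fix z assume "z \<in> qball y ((1/2) ^ K)"
      then show "z \<in> qball x r"
        using K rank_dist_triangle[of h x z y] by (auto simp: qball_def)
    qed
    moreover have "openin X (qball y ((1/2) ^ K))"
      unfolding qball_half N_ranks[symmetric] by (rule open_N)
    moreover have "y \<in> qball y ((1/2) ^ K)"
      using y by (simp add: qball_half)
    ultimately show "\<exists>T. openin X T \<and> y \<in> T \<and> T \<subseteq> qball x r" by blast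
  qed
  have "qtopology = X"
    unfolding topology_eq
  proof (intro allI iffI)
    fix U
    assume "openin qtopology U"
    then have "generate_topology_on {qball x r |x r. x \<in> topspace X \<and> 0 < r} U"
      by (simp add: qtopology_def openin_topology_generated_by_iff)
    then show "openin X U"
      by (rule generate_topology_on_coarsest[OF istopology_openin, rotated]) (use open_qball in auto)
  next
    fix U
    assume U: "openin X U"
    show "openin qtopology U"
    proof (subst openin_subopen, intro ballI)
      fix x assume x: "x \<in> U"
      then have xX: "x \<in> topspace X" using U openin_subset by blast
      obtain K where "{y \<in> topspace X. \<forall>k\<le>K. h k y \<le> h k x} \<subseteq> U"
        using nhd U x by blast
      then have "qball x ((1/2) ^ K) \<subseteq> U" "x \<in> qball x ((1/2) ^ K)"
        using xX by (auto simp: qball_half)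
      moreover have "openin qtopology (qball x ((1/2) ^ K))"
        unfolding qtopology_def by (rule topology_generated_by_Basis) (use xX in force)
      ultimately show "\<exists>T. openin qtopology T \<and> x \<in> T \<and> T \<subseteq> U" by blast
    qed
  qed
  moreover have Smyth_complete
    unfolding Smyth_complete_def
  proof (intro allI impI)
    fix \<sigma> assume "qCauchy \<sigma>"
    then have ran: "range \<sigma> \<subseteq> topspace X"
      and cau: "\<And>e. e > 0 \<Longrightarrow> \<exists>N. \<forall>n m. N \<le> n \<longrightarrow> n \<le> m \<longrightarrow> rank_dist h (\<sigma> n) (\<sigma> m) < e"
      by (auto simp: qCauchy_def)
    have "\<exists>c. \<forall>\<^sub>F n in sequentially. h k (\<sigma> n) = c" for k
    proof -
      obtain N where "\<And>n m. N \<le> n \<Longrightarrow> n \<le> m \<Longrightarrow> rank_dist h (\<sigma> n) (\<sigma> m) < (1/2) ^ k"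
        using cau[of "(1/2) ^ k"] by auto
      then have "\<And>n m. N \<le> n \<Longrightarrow> n \<le> m \<Longrightarrow> h k (\<sigma> m) \<le> h k (\<sigma> n)"
        by (simp add: rank_dist_less_iff)
      then show ?thesis by (rule enat_eventually_const)
    qed
    then obtain c where c: "\<And>k. \<forall>\<^sub>F n in sequentially. h k (\<sigma> n) = c k" by metis
    then obtain x where x: "x \<in> topspace X" "\<And>k. h k x = c k"
      using lim[OF ran] by blast
    interpret S: Metric_space "topspace X" sym_dist by (rule Metric_space_sym_dist)
    have "\<forall>\<^sub>F n in sequentially. \<sigma> n \<in> topspace X \<and> sym_dist (\<sigma> n) x < e" if e: "0 < e" for e
    proof -
      \<comment> \<open>Only the ranks up to \<open>K\<close> have to agree with those of
        \<open>x\<close>, which they do from some index on; agreement makes both distances small at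
        once.\<close>
      obtain K where K: "(1/2) ^ K < e" using small_half_power[OF e] .
      have "\<forall>\<^sub>F n in sequentially. \<forall>k\<in>{..K}. h k (\<sigma> n) = c k"
        using c by (simp add: eventually_ball_finite)
      then show ?thesis
      proof eventually_elim
        case (elim n)
        then have "rank_dist h (\<sigma> n) x < (1/2) ^ K" "rank_dist h x (\<sigma> n) < (1/2) ^ K"
          using x(2) by (simp_all add: rank_dist_less_iff)
        then show ?case using K ran by (auto simp: sym_dist_def)
      qed
    qed
    then show "\<exists>l. limitin S.mtopology \<sigma> l sequentially"
      using x(1) by (auto simp: S.limitin_metric)
  qed
  ultimately show ?thesis
    unfolding quasi_Polish_def using Quasi_metric_space_axioms by blast
qed

section \<open>Least elements of sets of naturals, with infinity for the empty set\<close>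

definition first_index :: "nat set \<Rightarrow> enat" where
  "first_index S = (if S = {} then \<infinity> else enat (LEAST j. j \<in> S))"

lemma first_index_le_iff: "first_index S \<le> enat m \<longleftrightarrow> (\<exists>j\<in>S. j \<le> m)"
  unfolding first_index_def
  by (auto intro: LeastI Least_le order_trans)

lemma first_index_eq_infinity_iff: "first_index S = \<infinity> \<longleftrightarrow> S = {}"
  by (simp add: first_index_def)

lemma first_index_mem: "first_index S = enat j \<Longrightarrow> j \<in> S"
  by (auto simp: first_index_def split: if_splits intro: LeastI)

text \<open>A finite least element is decided by membership up to it, so only finitely many
  memberships have to be controlled.\<close>

lemma first_index_eqI:
  assumes "first_index S = enat m" "\<And>j. j \<le> m \<Longrightarrow> j \<in> T \<longleftrightarrow> j \<in> S"
  shows "first_index T = enat m"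
proof (rule antisym)
  have "m \<in> S" using assms(1) by (rule first_index_mem)
  then show "first_index T \<le> enat m" using assms(2) by (auto simp: first_index_le_iff)
  show "enat m \<le> first_index T"
  proof (cases "first_index T")
    case (enat j)
    then have "j \<in> T" by (rule first_index_mem)
    show ?thesis
    proof (rule ccontr)
      assume "\<not> ?thesis"
      then have "j < m" using enat by simp
      then have "j \<in> S" using assms(2) \<open>j \<in> T\<close> by simp
      then have "first_index S \<le> enat j" by (auto simp: first_index_le_iff)
      then show False using assms(1) \<open>j < m\<close> by simp
    qed
  qed simp
qed

section \<open>Formal balls and limits in a Smyth-complete quasi-metric\<close>

context Quasi_metric_space
begin

lemma dist_self: "x \<in> M \<Longrightarrow> d x x = 0"
  using zero by blast

lemma openin_qball: "x \<in> M \<Longrightarrow> 0 < r \<Longrightarrow> openin qtopology (qball x r)"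
  unfolding qtopology_def by (rule topology_generated_by_Basis) blast

lemma openin_qtopology_nhd:
  assumes "openin qtopology U" "x \<in> U"
  obtains r where "0 < r" "qball x r \<subseteq> U"
proof -
  have "\<exists>r. 0 < r \<and> qball x r \<subseteq> U"
  proof (rule openin_topology_generated_by_nhd[OF assms[unfolded qtopology_def]])
    fix s assume "s \<in> {qball x r |x r. x \<in> M \<and> 0 < r}" "x \<in> s"
    then obtain y r where y: "s = qball y r" "y \<in> M" "x \<in> M" "d y x < r"
      by (auto simp: qball_def)
    have "qball x (r - d y x) \<subseteq> s"
    proof
      fix z assume "z \<in> qball x (r - d y x)"
      then show "z \<in> s" using y triangle[of y x z] by (auto simp: qball_def)
    qed
    then show "\<exists>t. 0 < t \<and> qball x t \<subseteq> s" using y(4) by (intro exI[of _ "r - d y x"]) simp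
  next
    fix t u :: real assume "0 < t" "0 < u"
    then show "\<exists>v. 0 < v \<and> qball x v \<subseteq> qball x t \<inter> qball x u"
      by (intro exI[of _ "min t u"]) (auto simp: qball_def)
  qed
  then show thesis using that by blast
qed

text \<open>If a basic open set satisfies \<open>C \<subseteq> qball x r\<close> for two of its own points \<open>x\<close>, then these
  are at distance less than \<open>r\<close> in both directions: so choosing one such point for each \<open>C\<close>
  and each \<open>r\<close> gives a dense sequence for the symmetrised metric. To include \<open>M = {}\<close>, the
  sequence may take values outside \<open>M\<close>.\<close>

lemma second_countable_imp_separable:
  assumes "second_countable qtopology"
  shows "\<exists>(r :: nat \<Rightarrow> real) (c :: nat \<Rightarrow> 'a). (\<forall>j. 0 < r j) \<and>
    (\<forall>x\<in>M. \<forall>e>0. \<exists>j. c j \<in> M \<and> r j < e \<and> d (c j) x < r j \<and> d x (c j) < r j)"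
proof -
  obtain \<B> where B: "countable \<B>"
    "\<forall>U x. openin qtopology U \<and> x \<in> U \<longrightarrow> (\<exists>V\<in>\<B>. x \<in> V \<and> V \<subseteq> U)"
    using assms unfolding second_countable_def by (elim exE conjE)
  \<comment> \<open>The index \<open>j\<close> codes a pair: the exponent of a radius and the
    position of a basic open set.\<close>
  define r where "r j = (1/2::real) ^ fst (prod_decode j)" for j
  define Q where "Q j x \<longleftrightarrow> x \<in> M \<and> x \<in> from_nat_into \<B> (snd (prod_decode j)) \<and>
    from_nat_into \<B> (snd (prod_decode j)) \<subseteq> qball x (r j)" for j x
  define c where "c j = (SOME x. Q j x)" for j
  show ?thesis
  proof (rule exI[of _ r], rule exI[of _ c], intro conjI allI ballI impI)
    show "0 < r j" for j by (simp add: r_def)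
    fix x and e :: real assume x: "x \<in> M" "0 < e"
    obtain k :: nat where k: "(1/2) ^ k < e" using small_half_power[OF x(2)] .
    have "x \<in> qball x ((1/2) ^ k)" using x by (simp add: qball_def dist_self)
    then obtain V where V: "V \<in> \<B>" "x \<in> V" "V \<subseteq> qball x ((1/2) ^ k)"
      using B(2)[rule_format, of "qball x ((1/2) ^ k)" x] openin_qball[OF x(1), of "(1/2) ^ k"] by auto
    then obtain n where n: "from_nat_into \<B> n = V"
      using B(1) by (metis from_nat_into_surj)
    define j where "j = prod_encode (k, n)"
    have Qx: "Q j x" using x V n by (simp add: Q_def j_def r_def)
    then have Qc: "Q j (c j)" unfolding c_def by (rule someI)
    then have "c j \<in> qball x (r j)" "x \<in> qball (c j) (r j)"
      using Qx unfolding Q_def by blast+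
    then show "\<exists>j. c j \<in> M \<and> r j < e \<and> d (c j) x < r j \<and> d x (c j) < r j"
      using Qc k by (intro exI[of _ j]) (auto simp: qball_def Q_def r_def j_def)
  qed
qed

text \<open>The hypothesis says that the balls are formal balls strictly nested with radii tending
  to 0. A Smyth limit of their centres then lies in the first ball, and, since it is also a limit
  for the reversed distance, each of its neighbourhoods contains one of the balls.\<close>

lemma nested_qballs_limit:
  assumes Smyth_complete and y: "\<And>k. y k \<in> M" and s: "\<And>k. 0 < s k" "\<And>k. s (Suc k) < (1/2) ^ k"
    and nested: "\<And>k. d (y k) (y (Suc k)) + s (Suc k) < s k"
  obtains x where "x \<in> qball (y 0) (s 0)"
    "\<And>z t. z \<in> M \<Longrightarrow> x \<in> qball z t \<Longrightarrow> \<exists>k. qball (y k) (s k) \<subseteq> qball z t"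
proof -
  \<comment> \<open>The strict inequalities between consecutive balls telescope. This bounds
    distances and later radii by earlier radii, but is not strict for \<open>k = m\<close>.\<close>
  have chain: "d (y k) (y m) + s m \<le> s k" if "k \<le> m" for k m
    using that
  proof (induction m rule: dec_induct)
    case base
    then show ?case by (simp add: dist_self y)
  next
    case (step m)
    then show ?case using nested[of m] triangle[OF y[of k] y[of m] y[of "Suc m"]] by linarith
  qed
  have s_small: "\<exists>N. \<forall>n\<ge>N. s n < e" if e: "0 < e" for e
  proof -
    obtain K :: nat where K: "(1/2) ^ K < e" using small_half_power[OF e] .
    have "s n < e" if "Suc K \<le> n" for n
      using chain[OF that] s(2)[of K] K nonneg[of "y (Suc K)" "y n"] by linarith
    then show ?thesis by blast
  qed
  have "qCauchy y"
    unfolding qCauchy_def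
  proof (intro conjI allI impI)
    show "range y \<subseteq> M" using y by auto
    fix e :: real assume "0 < e"
    then obtain N where N: "\<And>n. N \<le> n \<Longrightarrow> s n < e" using s_small by blast
    have "d (y n) (y m) < e" if "N \<le> n" "n \<le> m" for n m
      using N[OF that(1)] chain[OF that(2)] s(1)[of m] by linarith
    then show "\<exists>N. \<forall>n m. N \<le> n \<longrightarrow> n \<le> m \<longrightarrow> d (y n) (y m) < e" by blast
  qed
  then obtain x where "limitin (Metric_space.mtopology M sym_dist) y x sequentially"
    using assms(1) unfolding Smyth_complete_def by blast
  then have x: "x \<in> M" and "\<And>e. 0 < e \<Longrightarrow> \<exists>N. \<forall>n\<ge>N. y n \<in> M \<and> sym_dist (y n) x < e"
    by (auto simp: Metric_space.limit_metric_sequentially[OF Metric_space_sym_dist])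
  then have lim: "\<exists>N. \<forall>n\<ge>N. d (y n) x < e \<and> d x (y n) < e" if "0 < e" for e
    using that unfolding sym_dist_def by (metis max_less_iff_conj)
  show thesis
  proof (rule that)
    \<comment> \<open>The slack of the first, strict nesting. Spending it on the distance from
      \<open>y n\<close> to \<open>x\<close> keeps \<open>x\<close> inside the open ball, where
      \<open>chain\<close> alone would leave no room.\<close>
    define e where "e = s 0 - (d (y 0) (y 1) + s 1)"
    have "0 < e" using nested[of 0] by (simp add: e_def)
    then obtain n where n: "d (y n) x < e" "1 \<le> n" using lim[of e] by (meson nat_le_linear)
    have "d (y 0) x \<le> d (y 0) (y 1) + (d (y 1) (y n) + d (y n) x)"
      using triangle[OF y[of 0] y[of 1] x] triangle[OF y[of 1] y[of n] x] by linarith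
    then show "x \<in> qball (y 0) (s 0)"
      using chain[OF n(2)] s(1)[of n] n(1) x by (simp add: qball_def e_def)
  next
    fix z t assume z: "z \<in> M" and "x \<in> qball z t"
    then have "0 < (t - d z x) / 2" by (simp add: qball_def)
    then obtain N1 N2 where "\<And>n. N1 \<le> n \<Longrightarrow> d x (y n) < (t - d z x) / 2"
      "\<And>n. N2 \<le> n \<Longrightarrow> s n < (t - d z x) / 2"
      using lim s_small by meson
    then have N: "d x (y (max N1 N2)) < (t - d z x) / 2" "s (max N1 N2) < (t - d z x) / 2"
      by auto
    have "qball (y (max N1 N2)) (s (max N1 N2)) \<subseteq> qball z t"
    proof
      fix w assume "w \<in> qball (y (max N1 N2)) (s (max N1 N2))"
      then show "w \<in> qball z t"
        using N triangle[OF z x, of w] triangle[OF x y, of w "max N1 N2"]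
        by (auto simp: qball_def field_simps)
    qed
    then show "\<exists>k. qball (y k) (s k) \<subseteq> qball z t" by blast
  qed
qed

section \<open>Ranks of closed sets and the lower powerspace\<close>

lemma quasi_Polish_lower_powerspace:
  assumes "second_countable qtopology" and complete: Smyth_complete
  shows "quasi_Polish (lower_powerspace qtopology)"
proof -
  obtain r :: "nat \<Rightarrow> real" and c :: "nat \<Rightarrow> 'a" where r: "\<And>j. 0 < r j"
    and dense: "\<forall>x\<in>M. \<forall>e>0. \<exists>j. c j \<in> M \<and> r j < e \<and> d (c j) x < r j \<and> d x (c j) < r j"
    using second_countable_imp_separable[OF assms(1)] by blast
  define B where "B j = qball (c j) (r j)" for j
  \<comment> \<open>The strict order of formal balls with a bound on the smaller radius. Unlike mere
    inclusion of balls it controls the centres, as \<open>nested_qballs_limit\<close> requires. An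
    index with centre outside \<open>M\<close> has no refinement, so its ranks are all
    infinite.\<close>
  define R where
    "R i n = {j. c i \<in> M \<and> c j \<in> M \<and> r j < (1/2) ^ n \<and> d (c i) (c j) + r j < r i}"
    for i and n :: nat
  define rank where "rank i n A = first_index {j \<in> R i n. B j \<inter> A \<noteq> {}}" for i n A
  define h where "h k = rank (fst (prod_decode k)) (snd (prod_decode k))" for k
  have h_encode: "h (prod_encode (i, n)) = rank i n" for i n
    by (simp add: h_def)
  have open_B: "openin qtopology (B j)" if "c j \<in> M" for j
    unfolding B_def using that r by (rule openin_qball)
  have B_sub: "B j \<subseteq> B i" if "j \<in> R i n" for i j n
  proof
    fix x assume "x \<in> B j"
    then show "x \<in> B i"
      using that triangle[of "c i" "c j" x] by (auto simp: B_def R_def qball_def)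
  qed
  have refine: "\<exists>j\<in>R i n. x \<in> B j" if "c i \<in> M" "x \<in> B i" for i n x
  proof -
    have x: "x \<in> M" "d (c i) x < r i" using that by (auto simp: B_def qball_def)
    \<comment> \<open>Half of the slack pays for the distance from \<open>x\<close> to
      \<open>c j\<close>, the other half for the radius \<open>r j\<close>.\<close>
    define e where "e = min ((1/2) ^ n) ((r i - d (c i) x) / 2)"
    have "0 < e" using x by (simp add: e_def)
    then obtain j where j: "c j \<in> M" "r j < e" "d (c j) x < r j" "d x (c j) < r j"
      using dense x(1) by blast
    have "d (c i) (c j) + r j < r i"
      using triangle[OF that(1) x(1) j(1)] j(2,4) by (auto simp: e_def)
    then have "j \<in> R i n" using j that by (simp add: R_def e_def)
    moreover have "x \<in> B j" using j x by (simp add: B_def qball_def)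
    ultimately show ?thesis by blast
  qed
  have base: "\<exists>j. c j \<in> M \<and> x \<in> B j \<and> B j \<subseteq> U" if U: "openin qtopology U" "x \<in> U" for U x
  proof -
    obtain e where e: "0 < e" "qball x e \<subseteq> U" using openin_qtopology_nhd[OF U] .
    have x: "x \<in> M" using U openin_subset topspace_qtopology by blast
    obtain j where j: "c j \<in> M" "r j < e / 2" "d (c j) x < r j" "d x (c j) < r j"
      using dense x e(1) half_gt_zero by blast
    have "B j \<subseteq> qball x e"
    proof
      fix z assume "z \<in> B j"
      then show "z \<in> qball x e"
        using j triangle[OF x j(1), of z] by (auto simp: B_def qball_def)
    qed
    then show ?thesis using j x e(2) by (intro exI[of _ j]) (auto simp: B_def qball_def)
  qed
  \<comment> \<open>Finiteness of the rank is the same for all \<open>n\<close> and records whether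
    \<open>B i\<close> meets \<open>A\<close>. Hence \<open>n = 0\<close> suffices below wherever
    only this matters.\<close>
  have rank_infinity: "rank i n A = \<infinity> \<longleftrightarrow> B i \<inter> A = {}" if "c i \<in> M" for i n A
    unfolding rank_def first_index_eq_infinity_iff
    using B_sub[of _ i n] refine[OF that, of _ n] by blast
  have rank_invalid: "rank i n A = \<infinity>" if "c i \<notin> M" for i n A
    using that by (simp add: rank_def first_index_eq_infinity_iff R_def)

  let ?A = "lower_powerspace qtopology"
  show ?thesis
  proof (rule quasi_Polish_if_ranks[where h = h])
    fix k m
    obtain i n where k: "k = prod_encode (i, n)" by (metis prod_decode_inverse surj_pair)
    \<comment> \<open>Any witness up to \<open>m\<close> bounds the least one, so no ball has to be
      missed and the set is a union of diamonds.\<close>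
    have "{A \<in> topspace ?A. h k A \<le> enat m} =
        (\<Union>j\<in>{j \<in> R i n. j \<le> m}. diamond qtopology (B j))"
      by (auto simp: topspace_lower_powerspace k h_encode rank_def first_index_le_iff diamond_def)
    also have "openin ?A \<dots>"
    proof (intro openin_Union ballI; clarify)
      fix j assume "j \<in> R i n"
      then have "openin qtopology (B j)" using open_B by (simp add: R_def)
      then show "openin ?A (diamond qtopology (B j))"
        unfolding lower_powerspace_def by (intro topology_generated_by_Basis) auto
    qed
    finally show "openin ?A {A \<in> topspace ?A. h k A \<le> enat m}" .
  next
    fix \<U> A assume \<U>: "openin ?A \<U>" "A \<in> \<U>"
    have "\<exists>K. True \<and> {A' \<in> topspace ?A. \<forall>k\<le>K. h k A' \<le> h k A} \<subseteq> \<U>"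
    proof (rule openin_topology_generated_by_nhd[OF \<U>[unfolded lower_powerspace_def]])
      fix s assume s: "s \<in> insert {A. closedin qtopology A} {diamond qtopology U |U. openin qtopology U}"
        "A \<in> s"
      then consider "s = topspace ?A" | U where "s = diamond qtopology U" "openin qtopology U"
        by (auto simp: topspace_lower_powerspace)
      then show "\<exists>K. True \<and> {A' \<in> topspace ?A. \<forall>k\<le>K. h k A' \<le> h k A} \<subseteq> s"
      proof cases
        case 1
        then show ?thesis by auto
      next
        case (2 U)
        then obtain x where "x \<in> A" "x \<in> U" using s(2) by (auto simp: diamond_def)
        then obtain j where j: "c j \<in> M" "x \<in> B j" "B j \<subseteq> U" using base 2 by blast
        have "rank j 0 A \<noteq> \<infinity>" using j \<open>x \<in> A\<close> rank_infinity by blast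
        have "A' \<in> s" if A': "A' \<in> topspace ?A" "h (prod_encode (j, 0)) A' \<le> h (prod_encode (j, 0)) A" for A'
        proof -
          have "rank j 0 A' \<noteq> \<infinity>"
            using A'(2) \<open>rank j 0 A \<noteq> \<infinity>\<close> by (auto simp: h_encode dest: enat_ile)
          then have "B j \<inter> A' \<noteq> {}" by (simp only: rank_infinity[OF j(1)] not_False_eq_True)
          then show ?thesis
            using A'(1) j(3) unfolding 2(1) diamond_def topspace_lower_powerspace by blast
        qed
        then show ?thesis by (intro exI[of _ "prod_encode (j, 0)"]) auto
      qed
    next
      fix K L :: nat
      show "\<exists>N. True \<and> {A' \<in> topspace ?A. \<forall>k\<le>N. h k A' \<le> h k A} \<subseteq>
          {A' \<in> topspace ?A. \<forall>k\<le>K. h k A' \<le> h k A} \<inter> {A' \<in> topspace ?A. \<forall>k\<le>L. h k A' \<le> h k A}"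
        by (intro exI[of _ "max K L"]) auto
    qed
    then show "\<exists>K. {A' \<in> topspace ?A. \<forall>k\<le>K. h k A' \<le> h k A} \<subseteq> \<U>" by simp
  next
    fix A A' assume A: "A \<in> topspace ?A" "A' \<in> topspace ?A" and eq: "\<And>k. h k A = h k A'"
    have sub: "A1 \<subseteq> A2" if cl: "closedin qtopology A1" "closedin qtopology A2"
      and eq: "\<And>k. h k A1 = h k A2" for A1 A2
    proof (rule ccontr)
      assume "\<not> A1 \<subseteq> A2"
      then obtain x where x: "x \<in> A1" "x \<notin> A2" by blast
      have "openin qtopology (M - A2)" "x \<in> M - A2"
        using x cl closedin_subset[OF cl(1)] by (auto simp: closedin_def topspace_qtopology)
      then obtain j where j: "c j \<in> M" "x \<in> B j" "B j \<subseteq> M - A2" using base by blast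
      have "rank j 0 A1 = rank j 0 A2" using eq[of "prod_encode (j, 0)"] by (simp add: h_encode)
      then have "B j \<inter> A1 = {} \<longleftrightarrow> B j \<inter> A2 = {}" using rank_infinity[OF j(1)] by metis
      then show False using j x by blast
    qed
    show "A = A'"
      using A sub[of A A'] sub[of A' A] eq by (auto simp: topspace_lower_powerspace)
  next
    fix \<sigma> l assume \<sigma>: "range \<sigma> \<subseteq> topspace ?A"
      and lim: "\<And>k. \<forall>\<^sub>F n in sequentially. h k (\<sigma> n) = l k"
    have lim': "\<forall>\<^sub>F p in sequentially. rank i n (\<sigma> p) = l (prod_encode (i, n))" for i n
      using lim[of "prod_encode (i, n)"] by (simp add: h_encode)
    \<comment> \<open>The balls that the limit set has to meet. Since a limit rank is either finite
      or infinite, each ball with centre in \<open>M\<close> is eventually met or eventually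
      missed.\<close>
    define S where "S = {i. c i \<in> M \<and> (\<forall>\<^sub>F p in sequentially. B i \<inter> \<sigma> p \<noteq> {})}"
    have l_S: "i \<in> S \<longleftrightarrow> l (prod_encode (i, n)) \<noteq> \<infinity>" if "c i \<in> M" for i n
    proof -
      have "(\<forall>\<^sub>F p in sequentially. B i \<inter> \<sigma> p \<noteq> {}) \<longleftrightarrow>
          (\<forall>\<^sub>F p in sequentially. l (prod_encode (i, n)) \<noteq> \<infinity>)"
        using lim'[of i n] by (intro eventually_subst, eventually_elim) (metis rank_infinity[OF that])
      then show ?thesis using that by (simp add: S_def)
    qed
    have not_S: "\<forall>\<^sub>F p in sequentially. B i \<inter> \<sigma> p = {}" if "c i \<in> M" "i \<notin> S" for i
      using lim'[of i 0] l_S[OF that(1), of 0] that(2)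
      by (auto elim!: eventually_mono simp: rank_infinity[OF that(1)])
    have S_mono: "j \<in> S" if "i \<in> S" "B i \<subseteq> B j" "c j \<in> M" for i j
    proof -
      have "\<forall>\<^sub>F p in sequentially. B i \<inter> \<sigma> p \<noteq> {}" using that(1) by (simp add: S_def)
      then have "\<forall>\<^sub>F p in sequentially. B j \<inter> \<sigma> p \<noteq> {}"
        by eventually_elim (use that(2) in blast)
      then show ?thesis using that(3) by (simp add: S_def)
    qed
    \<comment> \<open>Here the ranks do their work: a finite limit rank \<open>j\<close> is a single
      witness shared by all late sets, so \<open>B j\<close> is itself eventually met. Knowing only
      that \<open>B i\<close> is eventually met would allow the witnesses to drift to
      infinity.\<close>
    have S_refine: "\<exists>j. j \<in> S \<and> j \<in> R i n" if i: "i \<in> S" for i n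
    proof -
      have "c i \<in> M" using i by (simp add: S_def)
      then obtain j where j: "l (prod_encode (i, n)) = enat j" using l_S i by auto
      have ev: "\<forall>\<^sub>F p in sequentially. j \<in> R i n \<and> B j \<inter> \<sigma> p \<noteq> {}"
        using lim'[of i n] by eventually_elim (use j first_index_mem in \<open>fastforce simp: rank_def\<close>)
      then have "j \<in> R i n" by (simp add: eventually_conj_iff)
      moreover have "j \<in> S"
        using ev \<open>j \<in> R i n\<close> by (simp add: S_def R_def)
      ultimately show ?thesis by blast
    qed
    \<comment> \<open>The largest closed set that misses all the balls it has to miss; that it meets
      those indexed by \<open>S\<close> is where completeness enters.\<close>
    define L where "L = M - (\<Union>i\<in>{i. c i \<in> M \<and> i \<notin> S}. B i)"
    have "openin qtopology (\<Union>i\<in>{i. c i \<in> M \<and> i \<notin> S}. B i)"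
      using open_B by auto
    from closedin_diff[OF closedin_topspace this] have closed_L: "closedin qtopology L"
      by (simp only: L_def topspace_qtopology)
    have L_S: "B i \<inter> L \<noteq> {}" if i: "i \<in> S" for i
    proof -
      \<comment> \<open>Refining with precision \<open>k\<close> at step \<open>k\<close> sends the
        radii to 0 while staying in \<open>S\<close>. A ball around the resulting limit contains
        some \<open>B (f k)\<close>, so by \<open>S_mono\<close> its index cannot lie outside
        \<open>S\<close>.\<close>
      have "\<exists>f. \<forall>k. (f k \<in> S \<and> (k = 0 \<longrightarrow> f k = i)) \<and> f (Suc k) \<in> R (f k) k"
        by (rule dependent_nat_choice) (use i S_refine in auto)
      then obtain f where f: "f 0 = i" "\<And>k. f k \<in> S" "\<And>k. f (Suc k) \<in> R (f k) k" by blast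
      obtain x where x: "x \<in> B i"
        and nhd: "\<And>z t. z \<in> M \<Longrightarrow> x \<in> qball z t \<Longrightarrow> \<exists>k. B (f k) \<subseteq> qball z t"
      proof (rule nested_qballs_limit[OF complete, of "c \<circ> f" "r \<circ> f"])
        show "(c \<circ> f) k \<in> M" for k using f(2)[of k] by (simp add: S_def)
      qed (use r f(1,3) in \<open>auto simp: B_def R_def\<close>)
      have "x \<notin> B j" if j: "c j \<in> M" "j \<notin> S" for j
      proof
        assume "x \<in> B j"
        then obtain k where "B (f k) \<subseteq> B j" using nhd j(1) unfolding B_def by blast
        then show False using S_mono f(2) that by blast
      qed
      moreover have "x \<in> M" using x by (simp add: B_def qball_def)
      ultimately show ?thesis using x by (auto simp: L_def)
    qed
    have agree: "\<forall>\<^sub>F p in sequentially. B j \<inter> \<sigma> p = {} \<longleftrightarrow> B j \<inter> L = {}" if "c j \<in> M" for j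
    proof (cases "j \<in> S")
      case True
      then have "\<forall>\<^sub>F p in sequentially. B j \<inter> \<sigma> p \<noteq> {}" by (simp add: S_def)
      then show ?thesis by eventually_elim (use L_S[OF True] in blast)
    next
      case False
      then have "B j \<inter> L = {}" using that by (auto simp: L_def)
      then show ?thesis using not_S[OF that False] by simp
    qed
    have "rank i n L = l (prod_encode (i, n))" for i n
    proof -
      have "\<forall>\<^sub>F p in sequentially. rank i n (\<sigma> p) = rank i n L"
      \<comment> \<open>A finite rank \<open>m\<close> depends only on the finitely many balls up to
        \<open>m\<close>, on which the sequence eventually agrees with \<open>L\<close>. An infinite
        rank depends on the one ball \<open>B i\<close>, or comes from a centre outside
        \<open>M\<close>.\<close>
      proof (cases "rank i n L")
        case (enat m)
        have "\<forall>\<^sub>F p in sequentially. \<forall>j\<in>R i n \<inter> {..m}. B j \<inter> \<sigma> p = {} \<longleftrightarrow> B j \<inter> L = {}"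
          by (intro eventually_ball_finite ballI agree) (auto simp: R_def)
        then show ?thesis
        proof eventually_elim
          case (elim p)
          show ?case
            unfolding enat rank_def[of _ _ "\<sigma> p"]
            by (rule first_index_eqI[OF enat[unfolded rank_def]]) (use elim in auto)
        qed
      next
        case infinity
        show ?thesis
        proof (cases "c i \<in> M")
          case True
          then have "B i \<inter> L = {}" using infinity rank_infinity by blast
          then show ?thesis
            using agree[OF True] by (simp add: infinity rank_infinity[OF True])
        qed (simp add: rank_invalid)
      qed
      with lim'[of i n] have "\<forall>\<^sub>F p in sequentially. rank i n L = l (prod_encode (i, n))"
        by eventually_elim simp
      then show ?thesis by simp
    qed
    then have "h k L = l k" for k by (simp add: h_def)
    then show "\<exists>x\<in>topspace ?A. \<forall>k. h k x = l k"
      using closed_L by (auto simp: topspace_lower_powerspace)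
  qed
qed

end

theorem theorem3p5:
  fixes X :: "'a topology"
  assumes "quasi_Polish X"
  shows "quasi_Polish (lower_powerspace X)"
proof -
  obtain d where d: "Quasi_metric_space (topspace X) d"
    "Quasi_metric_space.qtopology (topspace X) d = X"
    "Quasi_metric_space.Smyth_complete (topspace X) d"
    and "second_countable X"
    using assms unfolding quasi_Polish_def by blast
  then show ?thesis
    using Quasi_metric_space.quasi_Polish_lower_powerspace[OF d(1)] by simp
qed

end
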